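(* Let $\Lambda_1,\Lambda_2,\ldots$ be positive random variables, let $N(t)$, $t\ge0$, be a standard Poisson process (unit intensity) independent of the sequence $(\Lambda_n)$, and set $N_n=N(\Lambda_n)$. Let $X_1,X_2,\ldots$ be i.i.d. random variables with $a=\mathsf{E}X_1\neq0$ and finite variance $\sigma^2=\mathsf{D}X_1$, and assume that for each $n$ the random variable $N_n$ is independent of $X_1,X_2,\ldots$ (empty sums are $0$). Let $(m_n)_{n\ge1}$ be a sequence of positive numbers with $m_n\to\infty$, and let $\Lambda$ be a random variable with $\Lambda_n/m_n\Rightarrow\Lambda$ as $n\to\infty$. Let $1\le s\le2$ and write $s=m+\alpha$ with $m$ a nonnegative integer and $0<\alpha\le1$. Then for every $n$ $$ \zeta_s\bigg(\frac{1}{am_n}\sum_{j=1}^{N(\Lambda_n)}X_j,\;\Lambda\bigg)\le\frac{\mathsf{E}\Lambda_n^{s/2}}{m_n^{s}}\cdot\frac{\Gamma(1+\alpha)}{\Gamma(1+s)}\Big(1+\frac{\sigma^2}{a^2}\Big)^{s/2}+\zeta_s\Big(\frac{\Lambda_n}{m_n},\,\Lambda\Big). $$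
   Context: For $s>0$ write uniquely $s=m+\alpha$ with $m$ a nonnegative integer and $0<\alpha\le 1$. $\mathcal{F}_s$ denotes the set of all real-valued bounded functions $f$ on $\mathbb{R}$ that are $m$ times differentiable and satisfy $|f^{(m)}(x)-f^{(m)}(y)|\le|x-y|^{\alpha}$ for all $x,y$. The Zolotarev metric is $\zeta_s(X,Y)=\sup\{|\mathsf{E}(f(X)-f(Y))|: f\in\mathcal{F}_s\}$ (it depends only on the marginal distributions of $X$ and $Y$). $\Rightarrow$ denotes convergence in distribution. *)

theory Defs
  imports "HOL-Probability.Probability"
begin

text \<open>Decomposition s = m + alpha with m a nonnegative integer and 0 < alpha \<le> 1 (for s > 0).\<close>
definition zol_m :: "real \<Rightarrow> nat" where
  "zol_m s = nat (\<lceil>s\<rceil> - 1)"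

definition zol_alpha :: "real \<Rightarrow> real" where
  "zol_alpha s = s - real (zol_m s)"

definition zol_class :: "real \<Rightarrow> (real \<Rightarrow> real) set" where
  "zol_class s = {f. bounded (range f)
      \<and> (\<forall>k < zol_m s. \<forall>x. ((deriv ^^ k) f) differentiable (at x))
      \<and> (\<forall>x y. \<bar>(deriv ^^ zol_m s) f x - (deriv ^^ zol_m s) f y\<bar> \<le> \<bar>x - y\<bar> powr zol_alpha s)}"

text \<open>Zolotarev metric between two (probability) distributions on the real line;
  valued in the extended reals since the supremum may be infinite.\<close>
definition zolotarev :: "real \<Rightarrow> real measure \<Rightarrow> real measure \<Rightarrow> ereal" where
  "zolotarev s \<mu> \<nu> = (SUP f \<in> zol_class s. ereal \<bar>(\<integral>x. f x \<partial>\<mu>) - (\<integral>x. f x \<partial>\<nu>)\<bar>)"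

definition std_poisson_process :: "'a measure \<Rightarrow> (real \<Rightarrow> 'a \<Rightarrow> nat) \<Rightarrow> bool" where
  "std_poisson_process M N \<longleftrightarrow>
     (\<forall>t\<ge>0. N t \<in> measurable M (count_space UNIV))
   \<and> (\<forall>\<omega>\<in>space M. N 0 \<omega> = 0
        \<and> mono_on {0..} (\<lambda>t. N t \<omega>)
        \<and> (\<forall>t\<ge>0. continuous (at_right t) (\<lambda>t. N t \<omega>)))
   \<and> (\<forall>(tt :: nat \<Rightarrow> real) k. 0 \<le> tt 0 \<longrightarrow> (\<forall>i<k. tt i < tt (Suc i)) \<longrightarrow>
        prob_space.indep_vars M (\<lambda>_. count_space UNIV)
          (\<lambda>i \<omega>. N (tt (Suc i)) \<omega> - N (tt i) \<omega>) {..<k})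
   \<and> (\<forall>s t (j :: nat). 0 \<le> s \<longrightarrow> s \<le> t \<longrightarrow>
        measure M {\<omega> \<in> space M. N t \<omega> - N s \<omega> = j} = (t - s) ^ j / fact j * exp (- (t - s)))"

end

theory Submission
  imports Defs
begin

text \<open>
  Fix \<open>f\<close> in the class and condition on \<open>\<Lambda>\<^sub>n = t\<close>. The normalised sum \<open>Y\<close> is then compound Poisson
  with mean \<open>t / m\<^sub>n\<close> and variance \<open>v\<^sup>2 = t (1 + \<sigma>\<^sup>2 / a\<^sup>2) / m\<^sub>n\<^sup>2\<close>. A Taylor expansion of \<open>f\<close> (constant if \<open>s = 1\<close>, else linear) at
  the mean has remainder at most \<open>K |Y - t / m\<^sub>n|\<^sup>s\<close> with \<open>K = \<Gamma>(1 + \<alpha>) / \<Gamma>(1 + s)\<close>, its linear term has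
  expectation zero, and \<open>E |Y - t / m\<^sub>n|\<^sup>s \<le> v\<^sup>s\<close> by concavity of \<open>u \<mapsto> u\<^bsup>s/2\<^esup>\<close>. Integrating over
  \<open>\<Lambda>\<^sub>n\<close> bounds the distance to \<open>\<Lambda>\<^sub>n / m\<^sub>n\<close>; the triangle inequality does the rest.
  Joint independence of \<open>X\<close> and \<open>(\<Lambda>\<^sub>n, N)\<close> is not available, so the conditioning goes through the
  function \<open>g k = E f (S\<^sub>k / (a m\<^sub>n))\<close>: first \<open>E f (S\<^bsub>N\<^sub>n\<^esub> / (a m\<^sub>n)) = E (g N\<^sub>n)\<close> by independence of \<open>N\<^sub>n\<close>
  and \<open>X\<close>, then \<open>E (g N\<^sub>n)\<close> is computed from the independence of \<open>N\<close> and \<open>\<Lambda>\<^sub>n\<close>.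
\<close>

section \<open>Taylor expansion in the Zolotarev class\<close>

text \<open>With \<open>h = y - x\<close>, the derivative of
  \<open>f (x + t * h) - t * h * f' x\<close> in \<open>t\<close> is at most
  \<open>\<bar>h\<bar> powr (1 + \<alpha>) * t powr \<alpha>\<close> in absolute value. Comparison
  with the primitive \<open>\<psi>\<close> of this bound over [0, 1] produces the factor 1 / (1 +
  \<alpha>).\<close>

lemma holder_derivative_taylor_bound:
  fixes f f' :: "real \<Rightarrow> real"
  assumes f: "\<And>x. (f has_real_derivative f' x) (at x)"
    and holder: "\<And>x y. \<bar>f' x - f' y\<bar> \<le> \<bar>x - y\<bar> powr \<alpha>" and \<alpha>: "0 < \<alpha>"
  shows "\<bar>f y - f x - f' x * (y - x)\<bar> \<le> \<bar>y - x\<bar> powr (1 + \<alpha>) / (1 + \<alpha>)"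
proof -
  define h where "h = y - x"
  define \<phi> where "\<phi> t = f (x + t * h) - t * h * f' x" for t
  define \<psi> where "\<psi> t = \<bar>h\<bar> powr (1 + \<alpha>) * (t powr (1 + \<alpha>) / (1 + \<alpha>))" for t
  have "norm (\<phi> 1 - \<phi> 0) \<le> \<psi> 1 - \<psi> 0"
  \<comment> \<open>This mean value inequality asks for derivatives on the open interval only, which
    keeps the power function away from its base point 0.\<close>
  proof (rule differentiable_bound_general)
    have cf: "continuous_on UNIV f"
      using f by (auto intro!: continuous_at_imp_continuous_on DERIV_isCont)
    show "continuous_on {0..1} \<phi>"
      unfolding \<phi>_def
      by (intro continuous_intros continuous_on_compose2[OF cf]) auto
    show "continuous_on {0..1} \<psi>"
      unfolding \<psi>_def using \<alpha> by (auto intro!: continuous_intros continuous_on_powr')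
  next
    fix t :: real assume t: "0 < t" "t < 1"
    have "(\<phi> has_real_derivative (f' (x + t * h) * h - h * f' x)) (at t)"
      unfolding \<phi>_def
      by (auto intro!: derivative_eq_intros DERIV_chain'[OF _ f])
    then show "(\<phi> has_vector_derivative (f' (x + t * h) * h - h * f' x)) (at t)"
      by (simp add: has_real_derivative_iff_has_vector_derivative)
    have "((\<lambda>t. t powr (1 + \<alpha>)) has_real_derivative (1 + \<alpha>) * t powr \<alpha>) (at t)"
      using has_real_derivative_powr[of t "1 + \<alpha>"] t by simp
    from DERIV_cmult[OF DERIV_cdivide[OF this, of "1 + \<alpha>"], of "\<bar>h\<bar> powr (1 + \<alpha>)"]
    have "(\<psi> has_real_derivative (\<bar>h\<bar> powr (1 + \<alpha>) * t powr \<alpha>)) (at t)"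
      unfolding \<psi>_def using \<alpha> by simp
    then show "(\<psi> has_vector_derivative (\<bar>h\<bar> powr (1 + \<alpha>) * t powr \<alpha>)) (at t)"
      by (simp add: has_real_derivative_iff_has_vector_derivative)
    have "norm (f' (x + t * h) * h - h * f' x) = \<bar>h\<bar> * \<bar>f' (x + t * h) - f' x\<bar>"
      by (simp add: abs_mult[symmetric] algebra_simps)
    also have "\<dots> \<le> \<bar>h\<bar> * \<bar>t * h\<bar> powr \<alpha>"
      using holder[of "x + t * h" x] by (intro mult_left_mono) auto
    also have "\<dots> = \<bar>h\<bar> powr (1 + \<alpha>) * t powr \<alpha>"
      using t by (cases "h = 0") (auto simp: abs_mult powr_mult powr_add)
    finally show "norm (f' (x + t * h) * h - h * f' x) \<le> \<bar>h\<bar> powr (1 + \<alpha>) * t powr \<alpha>" .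
  qed simp
  then show ?thesis
    using \<alpha> by (simp add: \<phi>_def \<psi>_def h_def algebra_simps)
qed

text \<open>\<open>D\<close> is 0 for s = 1 and \<open>deriv f x\<close> otherwise; hiding it behind
  an existential lets everything later treat both cases at once. The Gamma ratio is 1 for s = 1, and
  \<open>Gamma s / Gamma (1 + s)\<close>, that is 1 / s, for s > 1.\<close>

lemma zol_class_taylor_bound:
  assumes s: "1 \<le> s" "s \<le> 2" and f: "f \<in> zol_class s"
  obtains D where "\<And>y. \<bar>f y - f x - D * (y - x)\<bar>
                    \<le> Gamma (1 + zol_alpha s) / Gamma (1 + s) * \<bar>y - x\<bar> powr s"
proof (cases "s = 1")
  case True
  \<comment> \<open>The convention 0 < alpha \<le> 1 puts s = 1 at m = 0 and alpha = 1, so the class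
    consists of bounded 1-Lipschitz functions.\<close>
  then have "zol_m s = 0" by (simp add: zol_m_def)
  with True f have "\<bar>f y - f x\<bar> \<le> \<bar>y - x\<bar>" for y
    by (auto simp: zol_class_def zol_alpha_def)
  with True \<open>zol_m s = 0\<close> show ?thesis
    by (intro that[of 0]) (auto simp: zol_alpha_def Gamma_numeral)
next
  case False
  then have "\<lceil>s\<rceil> = 2" using s by (intro ceiling_unique) auto
  then have m: "zol_m s = 1" by (simp add: zol_m_def)
  then have \<alpha>: "zol_alpha s = s - 1" by (simp add: zol_alpha_def)
  have "(f has_real_derivative deriv f x) (at x)" for x
    using f m by (simp add: zol_class_def DERIV_deriv_iff_real_differentiable)
  moreover have "\<bar>deriv f x - deriv f y\<bar> \<le> \<bar>x - y\<bar> powr (s - 1)" for x y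
    using f m \<alpha> by (simp add: zol_class_def)
  ultimately have *: "\<bar>f y - f x - deriv f x * (y - x)\<bar> \<le> \<bar>y - x\<bar> powr s / s" for y
    using holder_derivative_taylor_bound[of f "deriv f" "s - 1" y x] False s by simp
  have "s \<notin> \<int>\<^sub>\<le>\<^sub>0"
    using s by (auto elim!: nonpos_Ints_cases)
  then have "Gamma (1 + zol_alpha s) / Gamma (1 + s) = 1 / s"
    using Gamma_plus1[of s] s \<alpha> by (simp add: Gamma_eq_zero_iff add.commute)
  with * show ?thesis
    by (intro that[of "deriv f x"]) simp
qed

text \<open>The linear term and the Taylor remainder both vanish as \<open>y\<close> tends to
  \<open>x\<close>. Continuity is what later makes members of the class Borel measurable.\<close>

lemma zol_class_continuous:
  assumes "1 \<le> s" "s \<le> 2" "f \<in> zol_class s"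
  shows "continuous_on UNIV f"
proof (rule continuous_at_imp_continuous_on, rule ballI)
  fix x
  obtain D where D: "\<And>y. \<bar>f y - f x - D * (y - x)\<bar>
      \<le> Gamma (1 + zol_alpha s) / Gamma (1 + s) * \<bar>y - x\<bar> powr s"
    using zol_class_taylor_bound[OF assms, of x] by blast
  have "((\<lambda>y. Gamma (1 + zol_alpha s) / Gamma (1 + s) * \<bar>y - x\<bar> powr s) \<longlongrightarrow>
      Gamma (1 + zol_alpha s) / Gamma (1 + s) * \<bar>x - x\<bar> powr s) (at x)"
    using assms by (intro tendsto_intros tendsto_powr') auto
  then have "((\<lambda>y. f y - f x - D * (y - x)) \<longlongrightarrow> 0) (at x)"
    using D by (intro Lim_null_comparison[of "\<lambda>y. f y - f x - D * (y - x)"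
        "\<lambda>y. Gamma (1 + zol_alpha s) / Gamma (1 + s) * \<bar>y - x\<bar> powr s"]) auto
  moreover have "((\<lambda>y. f x + D * (y - x)) \<longlongrightarrow> f x + D * (x - x)) (at x)"
    by (intro tendsto_intros)
  ultimately have "((\<lambda>y. f y - f x - D * (y - x) + (f x + D * (y - x))) \<longlongrightarrow> 0 + (f x + D * (x - x))) (at x)"
    by (rule tendsto_add)
  then show "isCont f x"
    by (simp add: isCont_def)
qed

section \<open>A tangent-line form of Lyapunov's inequality\<close>

text \<open>The right side is the tangent at w = v^2 of the concave function w^(s/2), evaluated at w
  = u^2. Being affine in u^2, it can be averaged in several stages, and it becomes v^s once the mean
  of u^2 is v^2.\<close>

lemma powr_le_tangent_at:
  fixes u v s :: real
  assumes "0 \<le> s" "s \<le> 2" "0 < v"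
  shows "\<bar>u\<bar> powr s \<le> s / 2 * v powr (s - 2) * u\<^sup>2 + (1 - s / 2) * v powr s"
\<comment> \<open>At u = 0 the left side is 0 even for s = 0, by the convention
  \<open>0 powr 0 = 0\<close>.\<close>
proof (cases "u = 0")
  case False
  have sq: "u\<^sup>2 = \<bar>u\<bar> powr 2" "v\<^sup>2 = v powr 2"
    using False assms by simp_all
  have *: "(u\<^sup>2) powr (s / 2) = \<bar>u\<bar> powr s" "(v\<^sup>2) powr (1 - s / 2) = v powr (2 - s)"
    unfolding sq powr_powr by (simp_all add: algebra_simps)
  have "\<bar>u\<bar> powr s * v powr (2 - s) \<le> s / 2 * u\<^sup>2 + (1 - s / 2) * v\<^sup>2"
    using Youngs_inequality_0[of "s / 2" "1 - s / 2" "u\<^sup>2" "v\<^sup>2"] assms False by (simp add: *)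
  then have "\<bar>u\<bar> powr s * v powr (2 - s) * v powr (s - 2)
      \<le> (s / 2 * u\<^sup>2 + (1 - s / 2) * v\<^sup>2) * v powr (s - 2)"
    by (intro mult_right_mono) auto
  moreover have "v powr (2 - s) * v powr (s - 2) = 1" "v\<^sup>2 * v powr (s - 2) = v powr s"
    using assms unfolding sq by (simp_all add: powr_add[symmetric] del: powr_numeral)
  ultimately show ?thesis
    by (simp add: algebra_simps)
qed (use assms in auto)

section \<open>Poisson moments\<close>

text \<open>For nonnegative \<open>f\<close> a convergent series delivers integrability and the
  value together, so moments reduce to power series.\<close>

lemma (in prob_space) has_bochner_integral_nat_rv:
  fixes K :: "'a \<Rightarrow> nat" and f :: "nat \<Rightarrow> real"
  assumes [measurable]: "K \<in> measurable M (count_space UNIV)"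
    and f: "\<And>k. 0 \<le> f k" and sums: "(\<lambda>k. prob {\<omega> \<in> space M. K \<omega> = k} * f k) sums c"
  shows "has_bochner_integral M (\<lambda>\<omega>. f (K \<omega>)) c"
proof (rule has_bochner_integral_nn_integral)
  have eq: "distr M (count_space UNIV) K
      = density (count_space UNIV) (\<lambda>k. ennreal (prob {\<omega> \<in> space M. K \<omega> = k}))"
  proof (rule measure_eqI_countable[of _ UNIV])
    fix k :: nat
    have "emeasure (distr M (count_space UNIV) K) {k} = emeasure M {\<omega> \<in> space M. K \<omega> = k}"
      by (subst emeasure_distr) (auto intro!: arg_cong2[where f = emeasure])
    then show "emeasure (distr M (count_space UNIV) K) {k}
        = emeasure (density (count_space UNIV) (\<lambda>k. ennreal (prob {\<omega> \<in> space M. K \<omega> = k}))) {k}"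
      by (simp add: emeasure_density emeasure_eq_measure nn_integral_count_space_indicator[symmetric]
          nn_integral_count_space_finite)
  qed (auto simp: sets_density)
  have "(\<integral>\<^sup>+ \<omega>. ennreal (f (K \<omega>)) \<partial>M) = (\<integral>\<^sup>+ k. ennreal (f k) \<partial>distr M (count_space UNIV) K)"
    by (subst nn_integral_distr) auto
  also have "\<dots> = (\<Sum>k. ennreal (prob {\<omega> \<in> space M. K \<omega> = k} * f k))"
    by (simp add: eq nn_integral_density nn_integral_count_space_nat ennreal_mult f)
  also have "\<dots> = ennreal c"
    using sums f by (simp add: suminf_ennreal2 sums_iff)
  finally show "(\<integral>\<^sup>+ \<omega>. ennreal (f (K \<omega>)) \<partial>M) = ennreal c" .
  show "0 \<le> c"
    using sums_le[OF _ sums_zero sums] f by simp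
qed (use f in auto)

text \<open>The factor \<open>k\<close> cancels against the factorial, which makes each term
  \<open>t\<close> times the preceding one of a known series. The index shift is free because the
  term at k = 0 vanishes. Doing this twice gives the second sum.\<close>

lemma exp_sums_falling_factorial:
  fixes t :: real
  shows "(\<lambda>k. t ^ k / fact k * exp (- t) * of_nat k) sums t"
    and "(\<lambda>k. t ^ k / fact k * exp (- t) * (of_nat k * (of_nat k - 1))) sums t\<^sup>2"
proof -
  have e: "(\<lambda>k. t ^ k / fact k * exp (- t)) sums 1"
    using sums_mult2[OF exp_converges[of t], of "exp (- t)"]
    by (simp add: field_simps exp_minus)
  have "(\<lambda>k. t ^ Suc k / fact (Suc k) * exp (- t) * of_nat (Suc k)) sums t"
    using sums_mult[OF e, of t] by (simp add: field_simps del: of_nat_Suc)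
  then show 1: "(\<lambda>k. t ^ k / fact k * exp (- t) * of_nat k) sums t"
    by (subst (asm) sums_Suc_iff) simp
  have "(\<lambda>k. t ^ Suc k / fact (Suc k) * exp (- t) * (of_nat (Suc k) * (of_nat (Suc k) - 1))) sums t\<^sup>2"
    using sums_mult[OF 1, of t] by (simp add: power2_eq_square mult_ac)
  then show "(\<lambda>k. t ^ k / fact k * exp (- t) * (of_nat k * (of_nat k - 1))) sums t\<^sup>2"
    by (subst (asm) sums_Suc_iff) simp
qed

lemma (in prob_space) poisson_moments:
  fixes K :: "'a \<Rightarrow> nat"
  assumes K: "K \<in> measurable M (count_space UNIV)"
    and pois: "\<And>k. prob {\<omega> \<in> space M. K \<omega> = k} = t ^ k / fact k * exp (- t)"
  shows "has_bochner_integral M (\<lambda>\<omega>. real (K \<omega>)) t"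
    and "has_bochner_integral M (\<lambda>\<omega>. (real (K \<omega>) - t)\<^sup>2) t"
proof -
  show 1: "has_bochner_integral M (\<lambda>\<omega>. real (K \<omega>)) t"
    using has_bochner_integral_nat_rv[OF K, of real] exp_sums_falling_factorial(1)[of t]
    by (simp add: pois)
  have 2: "has_bochner_integral M (\<lambda>\<omega>. real (K \<omega>) * (real (K \<omega>) - 1)) (t\<^sup>2)"
  proof (rule has_bochner_integral_nat_rv[OF K])
    \<comment> \<open>The second factor is -1 at k = 0, but there the product is 0.\<close>
    show "0 \<le> real k * (real k - 1)" for k
      by (cases k) auto
  qed (use exp_sums_falling_factorial(2)[of t] in \<open>simp add: pois\<close>)
  \<comment> \<open>The square \<open>(real (K \<omega>) - t)\<^sup>2\<close> is rebuilt from the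
    factorial moment K (K - 1) and the mean.\<close>
  have "has_bochner_integral M
      (\<lambda>\<omega>. real (K \<omega>) * (real (K \<omega>) - 1) + (1 - 2 * t) * real (K \<omega>) + t\<^sup>2)
      (t\<^sup>2 + (1 - 2 * t) * t + t\<^sup>2 * prob (space M))"
    by (intro has_bochner_integral_add has_bochner_integral_mult_right 1 2)
      (auto simp: has_bochner_integral_iff)
  then show "has_bochner_integral M (\<lambda>\<omega>. (real (K \<omega>) - t)\<^sup>2) t"
    by (simp add: prob_space power2_eq_square algebra_simps)
qed

section \<open>Independence and iterated expectations\<close>

text \<open>Independence of the generated sigma-algebras, read on preimages, is the product formula
  on rectangles, and rectangles determine the product measure. This brings such hypotheses into a
  form that Fubini accepts.\<close>

lemma (in prob_space) distr_Pair_of_indep_vimage_algebras: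
  assumes [measurable]: "A \<in> measurable M S" "B \<in> measurable M T"
    and indep: "indep_set (sets (vimage_algebra (space M) A S)) (sets (vimage_algebra (space M) B T))"
  shows "distr M S A \<Otimes>\<^sub>M distr M T B = distr M (S \<Otimes>\<^sub>M T) (\<lambda>\<omega>. (A \<omega>, B \<omega>))"
proof (rule pair_measure_eqI)
  show "sigma_finite_measure (distr M S A)" "sigma_finite_measure (distr M T B)"
    by (auto intro!: prob_space_imp_sigma_finite prob_space_distr)
next
  fix U V assume "U \<in> sets (distr M S A)" "V \<in> sets (distr M T B)"
  then have [measurable]: "U \<in> sets S" "V \<in> sets T" by auto
  have "prob ((A -` U \<inter> space M) \<inter> (B -` V \<inter> space M))
      = prob (A -` U \<inter> space M) * prob (B -` V \<inter> space M)"
    by (rule indep_setD[OF indep]) (auto intro!: in_vimage_algebra)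
  moreover have "(\<lambda>\<omega>. (A \<omega>, B \<omega>)) -` (U \<times> V) \<inter> space M
      = (A -` U \<inter> space M) \<inter> (B -` V \<inter> space M)"
    by auto
  ultimately show "emeasure (distr M S A) U * emeasure (distr M T B) V
      = emeasure (distr M (S \<Otimes>\<^sub>M T) (\<lambda>\<omega>. (A \<omega>, B \<omega>))) (U \<times> V)"
    by (simp add: emeasure_distr emeasure_eq_measure ennreal_mult)
qed simp

text \<open>Fubini for the joint law: the inner expectation averages \<open>A\<close> while
  \<open>B \<omega>\<close> stays frozen.\<close>

lemma (in prob_space) expectation_indep_iterated:
  fixes h :: "'b \<times> 'c \<Rightarrow> real"
  assumes [measurable]: "A \<in> measurable M S" "B \<in> measurable M T"
    and indep: "indep_set (sets (vimage_algebra (space M) A S)) (sets (vimage_algebra (space M) B T))"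
    and [measurable]: "h \<in> borel_measurable (S \<Otimes>\<^sub>M T)" and bound: "\<And>z. \<bar>h z\<bar> \<le> C"
  shows "expectation (\<lambda>\<omega>. h (A \<omega>, B \<omega>))
       = expectation (\<lambda>\<omega>. expectation (\<lambda>\<omega>'. h (A \<omega>', B \<omega>)))"
proof -
  note eq = distr_Pair_of_indep_vimage_algebras[OF assms(1,2) indep]
  interpret A: prob_space "distr M S A" by (rule prob_space_distr) measurable
  interpret B: prob_space "distr M T B" by (rule prob_space_distr) measurable
  interpret P: pair_prob_space "distr M S A" "distr M T B" ..
  have int: "integrable (distr M S A \<Otimes>\<^sub>M distr M T B) (\<lambda>(a, b). h (a, b))"
    by (intro P.P.integrable_const_bound[where B = C]) (use bound in auto)
  have "expectation (\<lambda>\<omega>. h (A \<omega>, B \<omega>)) = (\<integral>z. h z \<partial>(distr M S A \<Otimes>\<^sub>M distr M T B))"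
    unfolding eq by (subst integral_distr) auto
  also have "\<dots> = (\<integral>b. (\<integral>a. h (a, b) \<partial>distr M S A) \<partial>distr M T B)"
    using P.integral_snd[OF int] by simp
  also have "\<dots> = expectation (\<lambda>\<omega>. \<integral>a. h (a, B \<omega>) \<partial>distr M S A)"
    by (subst integral_distr) auto
  also have "\<dots> = expectation (\<lambda>\<omega>. expectation (\<lambda>\<omega>'. h (A \<omega>', B \<omega>)))"
    by (intro Bochner_Integration.integral_cong refl, subst integral_distr)
      (auto dest: measurable_space)
  finally show ?thesis .
qed

section \<open>Moments of i.i.d. sums\<close>

text \<open>After centring, the second moment follows by induction on \<open>k\<close>: the cross
  term between the new summand and the preceding sum has mean zero by independence.\<close>

lemma (in prob_space) iid_sum_moments:
  fixes X :: "nat \<Rightarrow> 'a \<Rightarrow> real"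
  assumes rv: "\<And>j. X j \<in> borel_measurable M"
    and indep: "indep_vars (\<lambda>_. borel) X {1..}"
    and ident: "\<And>j. j \<ge> 1 \<Longrightarrow> distr M borel (X j) = distr M borel (X 1)"
    and L2: "integrable M (\<lambda>\<omega>. (X 1 \<omega>)\<^sup>2)"
  shows "has_bochner_integral M (\<lambda>\<omega>. \<Sum>j\<in>{1..k}. X j \<omega>) (k * expectation (X 1))"
    and "has_bochner_integral M (\<lambda>\<omega>. ((\<Sum>j\<in>{1..k}. X j \<omega>) - k * expectation (X 1))\<^sup>2)
           (k * variance (X 1))"
proof -
  note [measurable] = rv
  define a where "a = expectation (X 1)"
  define Z where "Z j \<omega> = X j \<omega> - a" for j \<omega>
  have [measurable]: "Z j \<in> borel_measurable M" for j
    unfolding Z_def by measurable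
  have L1: "integrable M (X 1)"
    using rv L2 by (rule square_integrable_imp_integrable)
  \<comment> \<open>Equal laws carry the integral of a Borel function of \<open>X 1\<close> over to
    \<open>X j\<close>.\<close>
  have transfer: "has_bochner_integral M (\<lambda>\<omega>. g (X j \<omega>)) c"
    if "has_bochner_integral M (\<lambda>\<omega>. g (X 1 \<omega>)) c" "g \<in> borel_measurable borel" "1 \<le> j"
    for g :: "real \<Rightarrow> real" and j c
  proof -
    have "has_bochner_integral (distr M borel (X 1)) g c"
      using that by (intro has_bochner_integral_distr) auto
    then show ?thesis
      unfolding ident[OF \<open>1 \<le> j\<close>, symmetric] has_bochner_integral_iff using that(2)
      by (simp add: integrable_distr_eq integral_distr)
  qed
  have Z1: "has_bochner_integral M (Z j) 0" if "1 \<le> j" for j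
  proof -
    have "has_bochner_integral M (\<lambda>\<omega>. X 1 \<omega> - a) (expectation (X 1) - a * prob (space M))"
      using L1 by (intro has_bochner_integral_diff) (auto simp: has_bochner_integral_iff)
    then have "has_bochner_integral M (\<lambda>\<omega>. X 1 \<omega> - a) 0"
      by (simp add: a_def prob_space)
    from transfer[OF this _ that] show ?thesis
      by (simp add: Z_def[abs_def])
  qed
  have Z2: "has_bochner_integral M (\<lambda>\<omega>. (Z j \<omega>)\<^sup>2) (variance (X 1))" if "1 \<le> j" for j
  proof -
    have "integrable M (\<lambda>\<omega>. (X 1 \<omega> - a)\<^sup>2)"
      using L1 L2 by (simp add: power2_diff)
    then have "has_bochner_integral M (\<lambda>\<omega>. (X 1 \<omega> - a)\<^sup>2) (variance (X 1))"
      by (simp add: has_bochner_integral_iff a_def)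
    from transfer[OF this _ that] show ?thesis
      by (simp add: Z_def[abs_def])
  qed
  have S1: "has_bochner_integral M (\<lambda>\<omega>. \<Sum>j\<in>{1..k}. Z j \<omega>) 0" for k
    using has_bochner_integral_sum[of "{1..k}" M Z "\<lambda>_. 0"] Z1 by simp
  have indepZ: "indep_vars (\<lambda>_. borel) Z {1..}"
    unfolding Z_def[abs_def] by (rule indep_vars_compose2[OF indep]) auto
  have S2: "has_bochner_integral M (\<lambda>\<omega>. (\<Sum>j\<in>{1..k}. Z j \<omega>)\<^sup>2) (k * variance (X 1))" for k
  proof (induction k)
    case (Suc k)
    have ind: "indep_var borel (Z (Suc k)) borel (\<lambda>\<omega>. \<Sum>j\<in>{1..k}. Z j \<omega>)"
      by (rule indep_vars_sum) (auto intro: indep_vars_subset[OF indepZ])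
    have I: "integrable M (Z (Suc k))" "integrable M (\<lambda>\<omega>. \<Sum>j\<in>{1..k}. Z j \<omega>)"
      and E: "expectation (Z (Suc k)) = 0"
      using Z1[of "Suc k"] S1[of k] by (auto simp: has_bochner_integral_iff)
    have "has_bochner_integral M (\<lambda>\<omega>. Z (Suc k) \<omega> * (\<Sum>j\<in>{1..k}. Z j \<omega>)) 0"
      using indep_var_integrable[OF ind I] indep_var_lebesgue_integral[OF ind I] E
      by (simp add: has_bochner_integral_iff)
    from has_bochner_integral_add[OF has_bochner_integral_add[OF Suc.IH
        has_bochner_integral_mult_right[OF this, of 2]] Z2[of "Suc k"]]
    show ?case
      by (simp add: power2_eq_square algebra_simps)
  qed (simp add: has_bochner_integral_zero)
  have sum_eq: "(\<Sum>j\<in>{1..k}. Z j \<omega>) = (\<Sum>j\<in>{1..k}. X j \<omega>) - k * a" for \<omega>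
    by (simp add: Z_def sum_subtractf)
  have "has_bochner_integral M (\<lambda>\<omega>. (\<Sum>j\<in>{1..k}. Z j \<omega>) + k * a) (0 + k * a * prob (space M))"
    by (intro has_bochner_integral_add S1) (auto simp: has_bochner_integral_iff)
  then show "has_bochner_integral M (\<lambda>\<omega>. \<Sum>j\<in>{1..k}. X j \<omega>) (k * expectation (X 1))"
    by (simp only: sum_eq prob_space) (simp add: a_def)
  show "has_bochner_integral M (\<lambda>\<omega>. ((\<Sum>j\<in>{1..k}. X j \<omega>) - k * expectation (X 1))\<^sup>2)
           (k * variance (X 1))"
    using S2[of k] unfolding sum_eq a_def .
qed

section \<open>A right-continuous process at an independent random time\<close>

text \<open>Adding 1 to the floor puts the dyadic point strictly above \<open>t\<close>, as the
  right-sided filter demands, and still within 2^(-j) of it.\<close>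

lemma dyadic_successor_tendsto_at_right:
  fixes t :: real
  shows "filterlim (\<lambda>j. (of_int \<lfloor>2 ^ j * t\<rfloor> + 1) / 2 ^ j) (at_right t) sequentially"
proof -
  have lb: "t < (of_int \<lfloor>2 ^ j * t\<rfloor> + 1) / 2 ^ j" for j
  proof -
    have "2 ^ j * t < of_int \<lfloor>2 ^ j * t\<rfloor> + 1" by linarith
    then show ?thesis by (simp add: field_simps)
  qed
  have ub: "(of_int \<lfloor>2 ^ j * t\<rfloor> + 1) / 2 ^ j \<le> t + (1 / 2) ^ j" for j
  proof -
    have "of_int \<lfloor>2 ^ j * t\<rfloor> + 1 \<le> 2 ^ j * t + 1" by linarith
    then show ?thesis by (simp add: field_simps)
  qed
  have "(\<lambda>j. t + (1 / 2) ^ j) \<longlonglongrightarrow> t + 0"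
    by (intro tendsto_intros) auto
  then have lim: "(\<lambda>j. t + (1 / 2) ^ j) \<longlonglongrightarrow> t"
    by simp
  have "(\<lambda>j. (of_int \<lfloor>2 ^ j * t\<rfloor> + 1) / 2 ^ j) \<longlonglongrightarrow> t"
    by (rule real_tendsto_sandwich[OF _ _ tendsto_const[of t] lim])
      (intro always_eventually allI less_imp_le lb ub)+
  then show ?thesis
    by (simp add: filterlim_at lb lb[THEN less_imp_neq, symmetric])
qed

text \<open>The time \<open>T\<close> is approximated from the right by dyadic times: for these the composition with
  the process is measurable on the product space, and right continuity passes to the limit.\<close>

lemma (in prob_space) expectation_at_independent_time:
  fixes N :: "real \<Rightarrow> 'a \<Rightarrow> nat" and \<psi> :: "nat \<Rightarrow> real"
  assumes N: "\<And>t. 0 \<le> t \<Longrightarrow> N t \<in> measurable M (count_space UNIV)"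
    and rc: "\<And>\<omega> t. \<omega> \<in> space M \<Longrightarrow> 0 \<le> t \<Longrightarrow> continuous (at_right t) (\<lambda>t. N t \<omega>)"
    and T: "\<And>\<omega>. \<omega> \<in> space M \<Longrightarrow> 0 \<le> T \<omega>"
    and T_rv[measurable]: "T \<in> borel_measurable M"
    and indep: "indep_set
          (sets (vimage_algebra (space M) (\<lambda>\<omega>. \<lambda>t\<in>{0..}. N t \<omega>) (PiM {0..} (\<lambda>_. count_space UNIV))))
          (sets (vimage_algebra (space M) T borel))"
    and bound: "\<And>k. \<bar>\<psi> k\<bar> \<le> C"
  shows "expectation (\<lambda>\<omega>. \<psi> (N (T \<omega>) \<omega>)) = expectation (\<lambda>\<omega>. expectation (\<lambda>\<omega>'. \<psi> (N (T \<omega>) \<omega>')))"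
    and "(\<lambda>\<omega>. expectation (\<lambda>\<omega>'. \<psi> (N (T \<omega>) \<omega>'))) \<in> borel_measurable M"
proof -
  have N_rv: "(\<lambda>\<omega>. \<lambda>t\<in>{0..}. N t \<omega>) \<in> measurable M (PiM {0..} (\<lambda>_. count_space UNIV))"
    using N by (intro measurable_restrict) auto
  define d where "d j t = (of_int \<lfloor>2 ^ j * t\<rfloor> + 1) / (2::real) ^ j" for j :: nat and t :: real
  \<comment> \<open>\<open>d'\<close> agrees with \<open>d\<close> for \<open>t \<ge> 0\<close> but
    runs through a natural-number index, the form that the countable composition rule
    handles.\<close>
  define d' where "d' j t = (of_nat (nat (\<lfloor>2 ^ j * t\<rfloor> + 1))) / (2::real) ^ j" for j :: nat and t :: real
  have d': "d' j t = d j t" if "0 \<le> t" for j t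
    using that by (simp add: d_def d'_def)
  have d_nonneg: "0 \<le> d j t" if "0 \<le> t" for j t
    using that by (simp add: d_def)
  have lim: "(\<lambda>j. \<psi> (N (d j t) \<omega>)) \<longlonglongrightarrow> \<psi> (N t \<omega>)" if "\<omega> \<in> space M" "0 \<le> t" for \<omega> t
  proof -
    have "filterlim (\<lambda>t. N t \<omega>) (nhds (N t \<omega>)) (at_right t)"
      using rc[OF that] by (simp add: continuous_within)
    \<comment> \<open>The values of \<open>N\<close> are discrete, so right continuity means being
      constant just to the right of \<open>t\<close>.\<close>
    then have "\<forall>\<^sub>F u in at_right t. N u \<omega> = N t \<omega>"
      by (simp add: nhds_discrete filterlim_principal)
    then have "\<forall>\<^sub>F j in sequentially. N (d j t) \<omega> = N t \<omega>"
      unfolding d_def by (rule eventually_compose_filterlim[OF _ dyadic_successor_tendsto_at_right])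
    then show ?thesis
      by (intro tendsto_eventually) (auto elim: eventually_mono)
  qed
  define Psi where "Psi t = expectation (\<lambda>\<omega>'. \<psi> (N t \<omega>'))" for t
  have Psi_bound: "\<bar>Psi t\<bar> \<le> C" if "0 \<le> t" for t
  proof -
    have "integrable M (\<lambda>\<omega>. \<psi> (N t \<omega>))"
      using N[OF that] bound by (intro integrable_const_bound[where B = C]) auto
    then have "Psi t \<le> C" "- C \<le> Psi t"
      unfolding Psi_def using bound
      by (auto intro!: integral_le_const integral_ge_const simp: abs_le_iff minus_le_iff)
    then show ?thesis by simp
  qed
  have Psi_lim: "(\<lambda>j. Psi (d j t)) \<longlonglongrightarrow> Psi t" if "0 \<le> t" for t
    unfolding Psi_def
    using N[OF that] N[OF d_nonneg[OF that]] lim[OF _ that] bound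
    by (intro integral_dominated_convergence[where w = "\<lambda>_. C"]) auto
  have Psi_d[measurable]: "(\<lambda>\<omega>. Psi (d j (T \<omega>))) \<in> borel_measurable M" for j
  proof -
    \<comment> \<open>\<open>Psi\<close> enters as an arbitrary function: measurability holds
      because its argument depends on \<open>T\<close> only through a natural number.\<close>
    have "(\<lambda>\<omega>. Psi (of_nat (nat (\<lfloor>2 ^ j * T \<omega>\<rfloor> + 1)) / 2 ^ j)) \<in> borel_measurable M"
      by measurable
    then show ?thesis
      using T d' by (subst measurable_cong[where g = "\<lambda>\<omega>. Psi (d' j (T \<omega>))"]) (auto simp: d'_def)
  qed
  show Psi_T: "(\<lambda>\<omega>. expectation (\<lambda>\<omega>'. \<psi> (N (T \<omega>) \<omega>'))) \<in> borel_measurable M"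
    unfolding Psi_def[symmetric]
    by (rule borel_measurable_LIMSEQ_real[of _ "\<lambda>j \<omega>. Psi (d j (T \<omega>))"]) (auto intro: Psi_lim T)
  have N_d[measurable]: "(\<lambda>\<omega>. \<psi> (N (d j (T \<omega>)) \<omega>)) \<in> borel_measurable M" for j
  proof -
    have "(\<lambda>\<omega>. \<psi> (N (of_nat (nat (\<lfloor>2 ^ j * T \<omega>\<rfloor> + 1)) / 2 ^ j) \<omega>)) \<in> borel_measurable M"
      by (rule measurable_compose_countable[where f = "\<lambda>i \<omega>. \<psi> (N (of_nat i / 2 ^ j) \<omega>)"])
        (auto intro: measurable_compose[OF N])
    then show ?thesis
      using T d' by (subst measurable_cong[where g = "\<lambda>\<omega>. \<psi> (N (d' j (T \<omega>)) \<omega>)"]) (auto simp: d'_def)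
  qed
  have step: "expectation (\<lambda>\<omega>. \<psi> (N (d j (T \<omega>)) \<omega>)) = expectation (\<lambda>\<omega>. Psi (d j (T \<omega>)))" for j
  proof -
    \<comment> \<open>For fixed \<open>j\<close> only countably many coordinates of the path are
      read, which makes this evaluation jointly measurable.\<close>
    let ?h = "\<lambda>(x, t). \<psi> (x (d' j t))"
    have "?h \<in> borel_measurable (PiM {0..} (\<lambda>_. count_space UNIV) \<Otimes>\<^sub>M borel)"
      unfolding d'_def split_beta
      by (rule measurable_compose_countable[where f = "\<lambda>i z. \<psi> (fst z (of_nat i / 2 ^ j))"])
        (auto intro!: measurable_compose[OF measurable_fst] measurable_compose[OF measurable_component_singleton])
    from expectation_indep_iterated[OF N_rv T_rv indep this, of C] bound
    have "expectation (\<lambda>\<omega>. \<psi> ((\<lambda>t\<in>{0..}. N t \<omega>) (d' j (T \<omega>))))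
        = expectation (\<lambda>\<omega>. expectation (\<lambda>\<omega>'. \<psi> ((\<lambda>t\<in>{0..}. N t \<omega>') (d' j (T \<omega>)))))"
      by auto
    then show ?thesis
      using T d_nonneg d' unfolding Psi_def
      by (simp cong: Bochner_Integration.integral_cong)
  qed
  have "(\<lambda>j. expectation (\<lambda>\<omega>. \<psi> (N (d j (T \<omega>)) \<omega>))) \<longlonglongrightarrow> expectation (\<lambda>\<omega>. \<psi> (N (T \<omega>) \<omega>))"
    using bound lim T
    by (intro integral_dominated_convergence[where w = "\<lambda>_. C"])
      (auto intro: borel_measurable_LIMSEQ_real[of _ "\<lambda>j \<omega>. \<psi> (N (d j (T \<omega>)) \<omega>)"])
  moreover have "(\<lambda>j. expectation (\<lambda>\<omega>. Psi (d j (T \<omega>)))) \<longlonglongrightarrow> expectation (\<lambda>\<omega>. Psi (T \<omega>))"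
    using Psi_T Psi_lim T Psi_bound d_nonneg
    by (intro integral_dominated_convergence[where w = "\<lambda>_. C"]) (auto simp: Psi_def[symmetric])
  ultimately show "expectation (\<lambda>\<omega>. \<psi> (N (T \<omega>) \<omega>))
      = expectation (\<lambda>\<omega>. expectation (\<lambda>\<omega>'. \<psi> (N (T \<omega>) \<omega>')))"
    unfolding step Psi_def[symmetric] by (rule LIMSEQ_unique)
qed

section \<open>Compound Poisson sums at a fixed intensity\<close>

lemma has_bochner_integral_abs_le:
  fixes u w :: "'a \<Rightarrow> real"
  assumes u: "has_bochner_integral M u p" and w: "has_bochner_integral M w q"
    and le: "\<And>x. x \<in> space M \<Longrightarrow> \<bar>u x\<bar> \<le> w x"
  shows "\<bar>p\<bar> \<le> q"
proof -
  have "\<bar>integral\<^sup>L M u\<bar> \<le> (\<integral>x. \<bar>u x\<bar> \<partial>M)"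
    using integral_norm_bound[of M u] by simp
  also have "\<dots> \<le> integral\<^sup>L M w"
    using u w by (intro integral_mono le) (auto simp: has_bochner_integral_iff)
  finally have "\<bar>integral\<^sup>L M u\<bar> \<le> integral\<^sup>L M w" .
  with u w show ?thesis
    by (simp add: has_bochner_integral_iff)
qed

lemma (in prob_space) has_bochner_integral_const_prob: "has_bochner_integral M (\<lambda>_. c :: real) c"
  by (simp add: has_bochner_integral_iff prob_space)

text \<open>The inner expectation averages \<open>X\<close> at a fixed count \<open>k\<close>, the
  outer one averages the count over the Poisson law. The tangent bound is affine in the squared
  deviation, so both averages of it are exact and end at the total variance
  \<open>v\<^sup>2\<close>.\<close>

lemma (in prob_space) compound_poisson_expectation_bound:
  fixes X :: "nat \<Rightarrow> 'a \<Rightarrow> real" and K :: "'a \<Rightarrow> nat" and f :: "real \<Rightarrow> real"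
  assumes X: "\<And>j. X j \<in> borel_measurable M" "indep_vars (\<lambda>_. borel) X {1..}"
      "\<And>j. j \<ge> 1 \<Longrightarrow> distr M borel (X j) = distr M borel (X 1)"
      "integrable M (\<lambda>\<omega>. (X 1 \<omega>)\<^sup>2)"
    and a: "a = expectation (X 1)" "a \<noteq> 0"
    and K: "K \<in> measurable M (count_space UNIV)"
    and pois: "\<And>k. prob {\<omega> \<in> space M. K \<omega> = k} = t ^ k / fact k * exp (- t)"
    and t: "0 < t" and m: "0 < m" and s: "0 \<le> s" "s \<le> 2" and G: "0 \<le> G"
    and f: "f \<in> borel_measurable borel" "\<And>y. \<bar>f y\<bar> \<le> C"
    and taylor: "\<And>y. \<bar>f y - f (t / m) - D * (y - t / m)\<bar> \<le> G * \<bar>y - t / m\<bar> powr s"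
  shows "\<bar>expectation (\<lambda>\<omega>. expectation (\<lambda>\<omega>'. f (1 / (a * m) * (\<Sum>j\<in>{1..K \<omega>}. X j \<omega>')))) - f (t / m)\<bar>
    \<le> G * (t powr (s / 2) * (1 + variance (X 1) / a\<^sup>2) powr (s / 2) / m powr s)"
proof -
  note [measurable] = X(1) K f(1)
  define V where "V = variance (X 1)"
  define g where "g k = expectation (\<lambda>\<omega>. f (1 / (a * m) * (\<Sum>j\<in>{1..k}. X j \<omega>)))" for k :: nat
  \<comment> \<open>The standard deviation of the normalised compound Poisson sum, taken as point of
    tangency so that nothing is lost after averaging.\<close>
  define v where "v = sqrt (t * (1 + V / a\<^sup>2)) / m"
  have V: "0 \<le> V" unfolding V_def by (rule variance_positive)
  have pos: "0 < 1 + V / a\<^sup>2" using V by (simp add: add_pos_nonneg)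
  have v: "0 < v" unfolding v_def using pos t m by simp
  have v2: "v\<^sup>2 = t * (1 + V / a\<^sup>2) / m\<^sup>2"
    using pos t by (simp add: v_def power_divide)
  have vs: "v powr s = t powr (s / 2) * (1 + V / a\<^sup>2) powr (s / 2) / m powr s"
  proof -
    have "v = (t * (1 + V / a\<^sup>2)) powr (1 / 2) / m"
      using pos t by (simp add: v_def powr_half_sqrt)
    then show ?thesis
      using pos t m by (simp add: powr_divide powr_mult powr_powr)
  qed
  \<comment> \<open>\<open>B\<close> is \<open>G\<close> times the tangent of q^(s/2) at q = v^2.
    \<open>Q k\<close> below is the mean square deviation from t / m at count \<open>k\<close>:
    squared bias plus the variance of \<open>k\<close> summands.\<close>
  define B where "B q = G * (s / 2 * v powr (s - 2) * q + (1 - s / 2) * v powr s)" for q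
  define Q where "Q k = ((real k - t)\<^sup>2 + V / a\<^sup>2 * real k) / m\<^sup>2" for k :: nat
  have g_int: "has_bochner_integral M (\<lambda>\<omega>. f (1 / (a * m) * (\<Sum>j\<in>{1..k}. X j \<omega>))) (g k)" for k
    unfolding has_bochner_integral_iff g_def
    by (intro conjI refl integrable_const_bound[where B = C]) (use f in auto)
  have g_bound: "\<bar>g k\<bar> \<le> C" for k
    by (rule has_bochner_integral_abs_le[OF g_int has_bochner_integral_const_prob]) (rule f)
  have key: "\<bar>g k - f (t / m) - D * ((real k - t) / m)\<bar> \<le> B (Q k)" for k
  proof (rule has_bochner_integral_abs_le)
    let ?Y = "\<lambda>\<omega>. 1 / (a * m) * (\<Sum>j\<in>{1..k}. X j \<omega>)"
    note S = iid_sum_moments[OF X, of k, folded V_def, folded a(1)]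
    have "has_bochner_integral M (\<lambda>\<omega>. ?Y \<omega> - t / m) (1 / (a * m) * (k * a) - t / m)"
      by (intro has_bochner_integral_diff has_bochner_integral_mult_right S(1) has_bochner_integral_const_prob)
    also have "1 / (a * m) * (k * a) - t / m = (real k - t) / m"
      using a m by (simp add: field_simps)
    finally have Y1: "has_bochner_integral M (\<lambda>\<omega>. ?Y \<omega> - t / m) ((real k - t) / m)" .
    show "has_bochner_integral M (\<lambda>\<omega>. f (?Y \<omega>) - f (t / m) - D * (?Y \<omega> - t / m))
        (g k - f (t / m) - D * ((real k - t) / m))"
      by (intro has_bochner_integral_diff has_bochner_integral_mult_right g_int
          has_bochner_integral_const_prob Y1)
    \<comment> \<open>With p = k / m and q = t / m, the square (y - q)^2 is written as (y - p)^2 + 2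
      (p - q) (y - q) - (p - q)^2, whose terms have known means.\<close>
    have "has_bochner_integral M (\<lambda>\<omega>. 1 / (a * m)\<^sup>2 * ((\<Sum>j\<in>{1..k}. X j \<omega>) - k * a)\<^sup>2
          + 2 * ((real k - t) / m) * (?Y \<omega> - t / m) - ((real k - t) / m)\<^sup>2)
        (1 / (a * m)\<^sup>2 * (k * V) + 2 * ((real k - t) / m) * ((real k - t) / m) - ((real k - t) / m)\<^sup>2)"
      by (intro has_bochner_integral_add has_bochner_integral_diff has_bochner_integral_mult_right
          has_bochner_integral_const_prob S Y1)
    also have "(\<lambda>\<omega>. 1 / (a * m)\<^sup>2 * ((\<Sum>j\<in>{1..k}. X j \<omega>) - k * a)\<^sup>2
          + 2 * ((real k - t) / m) * (?Y \<omega> - t / m) - ((real k - t) / m)\<^sup>2)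
        = (\<lambda>\<omega>. (?Y \<omega> - t / m)\<^sup>2)"
    proof
      fix \<omega>
      define y where "y = ?Y \<omega>"
      have "(\<Sum>j\<in>{1..k}. X j \<omega>) = a * m * y"
        using a m by (simp add: y_def)
      then have sq: "1 / (a * m)\<^sup>2 * ((\<Sum>j\<in>{1..k}. X j \<omega>) - k * a)\<^sup>2 = (y - k / m)\<^sup>2"
        using a m by (simp add: field_simps power2_eq_square)
      have "(y - p)\<^sup>2 + 2 * (p - q) * (y - q) - (p - q)\<^sup>2 = (y - q)\<^sup>2" for p q
        by (simp add: power2_eq_square algebra_simps)
      then show "1 / (a * m)\<^sup>2 * ((\<Sum>j\<in>{1..k}. X j \<omega>) - k * a)\<^sup>2
          + 2 * ((real k - t) / m) * (?Y \<omega> - t / m) - ((real k - t) / m)\<^sup>2 = (?Y \<omega> - t / m)\<^sup>2"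
        unfolding sq y_def[symmetric] diff_divide_distrib .
    qed
    also have "1 / (a * m)\<^sup>2 * (k * V) + 2 * ((real k - t) / m) * ((real k - t) / m)
        - ((real k - t) / m)\<^sup>2 = Q k"
      using a m by (simp add: Q_def field_simps power2_eq_square)
    finally have Y2: "has_bochner_integral M (\<lambda>\<omega>. (?Y \<omega> - t / m)\<^sup>2) (Q k)" .
    show "has_bochner_integral M (\<lambda>\<omega>. B ((?Y \<omega> - t / m)\<^sup>2)) (B (Q k))"
      unfolding B_def
      by (intro has_bochner_integral_add has_bochner_integral_mult_right
          has_bochner_integral_const_prob Y2)
    show "\<bar>f (?Y \<omega>) - f (t / m) - D * (?Y \<omega> - t / m)\<bar> \<le> B ((?Y \<omega> - t / m)\<^sup>2)" for \<omega>
      using taylor[of "?Y \<omega>"] mult_left_mono[OF powr_le_tangent_at[OF s v, of "?Y \<omega> - t / m"] G]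
      unfolding B_def by (rule order_trans)
  qed
  note P = poisson_moments[OF K pois]
  have "has_bochner_integral M (\<lambda>\<omega>. g (K \<omega>)) (expectation (\<lambda>\<omega>. g (K \<omega>)))"
    unfolding has_bochner_integral_iff
    by (intro conjI refl integrable_const_bound[where B = C]) (use g_bound in auto)
  \<comment> \<open>The Poisson mean is \<open>t\<close>, so the linear Taylor term averages to
    \<open>D * ((t - t) / m)\<close>, which is 0.\<close>
  then have "has_bochner_integral M (\<lambda>\<omega>. g (K \<omega>) - f (t / m) - D * ((real (K \<omega>) - t) / m))
      (expectation (\<lambda>\<omega>. g (K \<omega>)) - f (t / m) - D * ((t - t) / m))"
    by (intro has_bochner_integral_diff has_bochner_integral_mult_right has_bochner_integral_divide
        has_bochner_integral_const_prob P)
  moreover have "has_bochner_integral M (\<lambda>\<omega>. B (Q (K \<omega>))) (B ((t + V / a\<^sup>2 * t) / m\<^sup>2))"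
    unfolding B_def Q_def
    by (intro has_bochner_integral_add has_bochner_integral_mult_right has_bochner_integral_divide
        has_bochner_integral_const_prob P)
  ultimately have "\<bar>expectation (\<lambda>\<omega>. g (K \<omega>)) - f (t / m) - D * ((t - t) / m)\<bar>
      \<le> B ((t + V / a\<^sup>2 * t) / m\<^sup>2)"
    by (rule has_bochner_integral_abs_le) (rule key)
  also have "(t + V / a\<^sup>2 * t) / m\<^sup>2 = v\<^sup>2"
    by (simp add: v2 algebra_simps)
  \<comment> \<open>At the point of tangency the tangent meets the power function.\<close>
  also have "B (v\<^sup>2) = G * v powr s"
  proof -
    have "v powr (s - 2) * v\<^sup>2 = v powr s"
      using v by (simp add: powr_diff)
    then show ?thesis
      unfolding B_def mult.assoc by (simp add: algebra_simps)
  qed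
  finally show ?thesis
    unfolding vs by (simp add: g_def V_def)
qed

section \<open>Mixed Poisson sums and the Zolotarev bound\<close>

lemma (in prob_space) indep_set_commute: "indep_set U V \<Longrightarrow> indep_set V U"
  by (rule indep_setI)
    (auto dest: indep_setD_ev1 indep_setD_ev2 indep_setD simp: Int_commute[of _ "_ :: 'a set"] mult.commute)

lemma (in prob_space) indep_set_subset_right: "indep_set U V \<Longrightarrow> W \<subseteq> V \<Longrightarrow> indep_set U W"
  by (intro indep_setI) (auto dest: indep_setD_ev1 indep_setD_ev2 intro: indep_setD)

text \<open>\<open>indep_set\<close> includes the claim that the members of both families are
  events, hence preimages under \<open>A\<close> are measurable.\<close>

lemma (in prob_space) indep_set_vimage_algebra_measurable_left:
  assumes "indep_set (sets (vimage_algebra (space M) A S)) V" "A \<in> space M \<rightarrow> space S"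
  shows "A \<in> measurable M S"
proof (rule measurableI)
  show "A -` U \<inter> space M \<in> events" if "U \<in> sets S" for U
    using indep_setD_ev1[OF assms(1)] in_vimage_algebra[OF that] by auto
qed (use assms(2) in auto)

theorem theorem1:
  fixes M :: "'a measure"
    and Lam :: "nat \<Rightarrow> 'a \<Rightarrow> real"
    and N :: "real \<Rightarrow> 'a \<Rightarrow> nat"
    and X :: "nat \<Rightarrow> 'a \<Rightarrow> real"
    and mm :: "nat \<Rightarrow> real"
    and L :: "'a \<Rightarrow> real"
    and a \<sigma> s :: real
  assumes "prob_space M"
    and Lam_rv: "\<And>n. Lam n \<in> borel_measurable M"
    and Lam_pos: "\<And>n \<omega>. \<omega> \<in> space M \<Longrightarrow> Lam n \<omega> > 0"
    and N_poisson: "std_poisson_process M N"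
    and N_indep_Lam: "prob_space.indep_set M
          (sets (vimage_algebra (space M) (\<lambda>\<omega>. \<lambda>t\<in>{0..}. N t \<omega>) (PiM {0..} (\<lambda>_. count_space UNIV))))
          (sets (vimage_algebra (space M) (\<lambda>\<omega>. \<lambda>n. Lam n \<omega>) (PiM UNIV (\<lambda>_. borel))))"
    and X_rv: "\<And>j. X j \<in> borel_measurable M"
    and X_indep: "prob_space.indep_vars M (\<lambda>_. borel) X {1..}"
    and X_ident: "\<And>j. j \<ge> 1 \<Longrightarrow> distr M borel (X j) = distr M borel (X 1)"
    and X_L2: "integrable M (\<lambda>\<omega>. (X 1 \<omega>)\<^sup>2)"
    and a_def: "a = prob_space.expectation M (X 1)"
    and a_nz: "a \<noteq> 0"
    and sigma_def: "\<sigma>\<^sup>2 = prob_space.variance M (X 1)"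
    and NX_indep: "\<And>n. prob_space.indep_set M
          (sets (vimage_algebra (space M) (\<lambda>\<omega>. N (Lam n \<omega>) \<omega>) (count_space UNIV)))
          (sets (vimage_algebra (space M) (\<lambda>\<omega>. \<lambda>j. X j \<omega>) (PiM UNIV (\<lambda>_. borel))))"
    and mm_pos: "\<And>n. mm n > 0"
    and mm_inf: "filterlim mm at_top sequentially"
    and L_rv: "L \<in> borel_measurable M"
    and L_lim: "weak_conv_m (\<lambda>n. distr M borel (\<lambda>\<omega>. Lam n \<omega> / mm n)) (distr M borel L)"
    and s_ge: "1 \<le> s" and s_le: "s \<le> 2"
  shows "\<forall>n. zolotarev s
            (distr M borel (\<lambda>\<omega>. (1 / (a * mm n)) * (\<Sum>j\<in>{1..N (Lam n \<omega>) \<omega>}. X j \<omega>)))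
            (distr M borel L)
         \<le> enn2ereal (\<integral>\<^sup>+\<omega>. ennreal (Lam n \<omega> powr (s / 2)) \<partial>M)
             * ereal (1 / mm n powr s
                      * (Gamma (1 + zol_alpha s) / Gamma (1 + s))
                      * (1 + \<sigma>\<^sup>2 / a\<^sup>2) powr (s / 2))
           + zolotarev s (distr M borel (\<lambda>\<omega>. Lam n \<omega> / mm n)) (distr M borel L)"
proof
  fix n
  interpret prob_space M by fact
  note [measurable] = Lam_rv X_rv L_rv
  let ?m = "mm n" and ?T = "Lam n"
  let ?c = "1 / (a * ?m)"
  let ?K = "\<lambda>\<omega>. N (?T \<omega>) \<omega>"
  define G where "G = Gamma (1 + zol_alpha s) / Gamma (1 + s)"
  define H where "H = 1 / ?m powr s * G * (1 + \<sigma>\<^sup>2 / a\<^sup>2) powr (s / 2)"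
  have "zol_m s \<le> 1" "zol_alpha s \<ge> 0"
    using s_ge s_le ceiling_correct[of s] by (auto simp: zol_m_def zol_alpha_def)
  then have G: "0 \<le> G"
    unfolding G_def using s_ge by (auto intro!: divide_nonneg_nonneg less_imp_le Gamma_real_pos)
  then have H: "0 \<le> H"
    unfolding H_def by simp
  have N: "N t \<in> measurable M (count_space UNIV)" if "0 \<le> t" for t
    using N_poisson that by (simp add: std_poisson_process_def)
  have rc: "continuous (at_right t) (\<lambda>t. N t \<omega>)" if "\<omega> \<in> space M" "0 \<le> t" for \<omega> t
    using N_poisson that by (simp add: std_poisson_process_def)
  have pois: "prob {\<omega> \<in> space M. N t \<omega> = k} = t ^ k / fact k * exp (- t)" if "0 \<le> t" for t k
  proof -
    \<comment> \<open>The law of \<open>N t\<close> is that of the increment from time 0, where the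
      process starts at 0.\<close>
    have "prob {\<omega> \<in> space M. N t \<omega> - N 0 \<omega> = k} = (t - 0) ^ k / fact k * exp (- (t - 0))"
      using N_poisson that unfolding std_poisson_process_def by blast
    moreover have "{\<omega> \<in> space M. N t \<omega> - N 0 \<omega> = k} = {\<omega> \<in> space M. N t \<omega> = k}"
      using N_poisson by (auto simp: std_poisson_process_def)
    ultimately show ?thesis by simp
  qed
  have seq_rv: "(\<lambda>\<omega>. \<lambda>j. X j \<omega>) \<in> measurable M (PiM UNIV (\<lambda>_. borel))"
    by (rule measurable_PiM_single') auto
  \<comment> \<open>Measurability of the process at the random time is extracted from the
    independence hypothesis on it.\<close>
  have K_rv[measurable]: "?K \<in> measurable M (count_space UNIV)"
    using NX_indep by (rule indep_set_vimage_algebra_measurable_left) auto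
  \<comment> \<open>The process is independent of the whole sequence; projecting to coordinate
    \<open>n\<close> restricts this to the single time \<open>?T\<close>.\<close>
  have "sets (vimage_algebra (space M) ?T borel)
      \<subseteq> sets (vimage_algebra (space M) (\<lambda>\<omega>. \<lambda>n. Lam n \<omega>) (PiM UNIV (\<lambda>_. borel)))"
  proof (rule sets_image_in_sets)
    have "(\<lambda>\<omega>. \<lambda>n. Lam n \<omega>)
        \<in> measurable (vimage_algebra (space M) (\<lambda>\<omega>. \<lambda>n. Lam n \<omega>) (PiM UNIV (\<lambda>_. borel))) (PiM UNIV (\<lambda>_. borel))"
      by (rule measurable_vimage_algebra1) (auto simp: space_PiM)
    from measurable_compose[OF this measurable_component_singleton[of n]]
    show "?T \<in> borel_measurable (vimage_algebra (space M) (\<lambda>\<omega>. \<lambda>n. Lam n \<omega>) (PiM UNIV (\<lambda>_. borel)))"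
      by simp
  qed simp
  note NT_indep = indep_set_subset_right[OF N_indep_Lam this]
  have bound: "ereal \<bar>expectation (\<lambda>\<omega>. f (?c * (\<Sum>j\<in>{1..?K \<omega>}. X j \<omega>))) - expectation (\<lambda>\<omega>. f (?T \<omega> / ?m))\<bar>
      \<le> enn2ereal (\<integral>\<^sup>+\<omega>. ennreal (?T \<omega> powr (s / 2)) \<partial>M) * ereal H"
    if f: "f \<in> zol_class s" for f
  proof -
    from f obtain C where C: "\<And>y. \<bar>f y\<bar> \<le> C"
      by (auto simp: zol_class_def bounded_iff)
    have [measurable]: "f \<in> borel_measurable borel"
      using zol_class_continuous[OF s_ge s_le f] by (rule borel_measurable_continuous_onI)
    \<comment> \<open>\<open>g\<close> integrates out the summands at a fixed count,
      \<open>Psi\<close> then integrates out the Poisson count at a fixed time.\<close>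
    define g where "g k = expectation (\<lambda>\<omega>. f (?c * (\<Sum>j\<in>{1..k}. X j \<omega>)))" for k :: nat
    define Psi where "Psi t = expectation (\<lambda>\<omega>. g (N t \<omega>))" for t
    have g_bound: "\<bar>g k\<bar> \<le> C" for k
    proof -
      have "integrable M (\<lambda>\<omega>. f (?c * (\<Sum>j\<in>{1..k}. X j \<omega>)))"
        by (intro integrable_const_bound[where B = C]) (use C in auto)
      then show ?thesis unfolding g_def
        by (intro has_bochner_integral_abs_le[OF has_bochner_integral_integrable
              has_bochner_integral_const_prob] C)
    qed
    have "(\<lambda>(x, k :: nat). f (?c * (\<Sum>j\<in>{1..k}. x j)))
        \<in> borel_measurable (PiM UNIV (\<lambda>_. borel) \<Otimes>\<^sub>M count_space UNIV)"
      unfolding split_beta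
      by (rule measurable_compose_countable[where f = "\<lambda>k z. f (?c * (\<Sum>j\<in>{1..k}. fst z j))" and g = snd])
        measurable
    \<comment> \<open>The summands must be averaged inside, with the count frozen, hence the swapped
      order of independence.\<close>
    from expectation_indep_iterated[OF seq_rv K_rv indep_set_commute[OF NX_indep] this, of C] C
    have "expectation (\<lambda>\<omega>. f (?c * (\<Sum>j\<in>{1..?K \<omega>}. X j \<omega>))) = expectation (\<lambda>\<omega>. g (?K \<omega>))"
      by (auto simp: g_def)
    also have "\<dots> = expectation (\<lambda>\<omega>. Psi (?T \<omega>))"
      unfolding Psi_def
      by (rule expectation_at_independent_time(1)[OF N rc _ Lam_rv NT_indep g_bound])
        (auto intro: less_imp_le Lam_pos)
    finally have E: "expectation (\<lambda>\<omega>. f (?c * (\<Sum>j\<in>{1..?K \<omega>}. X j \<omega>))) = expectation (\<lambda>\<omega>. Psi (?T \<omega>))" .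
    have Psi_rv[measurable]: "(\<lambda>\<omega>. Psi (?T \<omega>)) \<in> borel_measurable M"
      unfolding Psi_def
      by (rule expectation_at_independent_time(2)[OF N rc _ Lam_rv NT_indep g_bound])
        (auto intro: less_imp_le Lam_pos)
    have Psi_bound: "\<bar>Psi t\<bar> \<le> C" if "0 < t" for t
    proof -
      have "integrable M (\<lambda>\<omega>. g (N t \<omega>))"
        using N[of t] that by (intro integrable_const_bound[where B = C]) (use g_bound in auto)
      then show ?thesis unfolding Psi_def
        by (intro has_bochner_integral_abs_le[OF has_bochner_integral_integrable
              has_bochner_integral_const_prob] g_bound)
    qed
    have diff: "\<bar>Psi t - f (t / ?m)\<bar> \<le> t powr (s / 2) * H" if t: "0 < t" for t
    proof -
      \<comment> \<open>The slope is chosen separately for each \<open>t\<close>; the resulting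
        bound is free of it, so its dependence on \<open>t\<close> is harmless.\<close>
      obtain D where "\<And>y. \<bar>f y - f (t / ?m) - D * (y - t / ?m)\<bar> \<le> G * \<bar>y - t / ?m\<bar> powr s"
        using zol_class_taylor_bound[OF s_ge s_le f, of "t / ?m"] unfolding G_def by blast
      then have "\<bar>Psi t - f (t / ?m)\<bar>
          \<le> G * (t powr (s / 2) * (1 + variance (X 1) / a\<^sup>2) powr (s / 2) / ?m powr s)"
        unfolding Psi_def g_def using t s_ge s_le
        by (intro compound_poisson_expectation_bound[OF X_rv X_indep X_ident X_L2 a_def a_nz N pois
              _ mm_pos _ _ G _ C]) auto
      then show ?thesis
        by (simp add: H_def sigma_def mult_ac)
    qed
    have int: "integrable M (\<lambda>\<omega>. Psi (?T \<omega>))" "integrable M (\<lambda>\<omega>. f (?T \<omega> / ?m))"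
      by (intro integrable_const_bound[where B = C]; use C Psi_bound Lam_pos in force)+
    \<comment> \<open>The estimate moves to extended nonnegative reals because the moment of order s
      / 2 of \<open>?T\<close> may be infinite.\<close>
    have "ennreal \<bar>expectation (\<lambda>\<omega>. Psi (?T \<omega>)) - expectation (\<lambda>\<omega>. f (?T \<omega> / ?m))\<bar>
        = ennreal (norm (expectation (\<lambda>\<omega>. Psi (?T \<omega>) - f (?T \<omega> / ?m))))"
      using int by simp
    also have "\<dots> \<le> (\<integral>\<^sup>+\<omega>. ennreal (norm (Psi (?T \<omega>) - f (?T \<omega> / ?m))) \<partial>M)"
      using int by (intro integral_norm_bound_ennreal) auto
    also have "\<dots> \<le> (\<integral>\<^sup>+\<omega>. ennreal (?T \<omega> powr (s / 2)) * ennreal H \<partial>M)"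
      using diff Lam_pos H by (intro nn_integral_mono) (auto simp: ennreal_mult[symmetric] intro!: ennreal_leI)
    also have "\<dots> = (\<integral>\<^sup>+\<omega>. ennreal (?T \<omega> powr (s / 2)) \<partial>M) * ennreal H"
      by (rule nn_integral_multc) measurable
    finally show ?thesis
      unfolding E less_eq_ennreal.rep_eq times_ennreal.rep_eq using H by (simp add: enn2ereal_ennreal)
  qed
  show "zolotarev s (distr M borel (\<lambda>\<omega>. ?c * (\<Sum>j\<in>{1..?K \<omega>}. X j \<omega>))) (distr M borel L)
      \<le> enn2ereal (\<integral>\<^sup>+\<omega>. ennreal (?T \<omega> powr (s / 2)) \<partial>M)
          * ereal (1 / ?m powr s * (Gamma (1 + zol_alpha s) / Gamma (1 + s)) * (1 + \<sigma>\<^sup>2 / a\<^sup>2) powr (s / 2))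
        + zolotarev s (distr M borel (\<lambda>\<omega>. ?T \<omega> / ?m)) (distr M borel L)"
    \<comment> \<open>Only the distance on the left is opened as a supremum; the one on the right
      stays folded as the bound for the second leg of the triangle inequality.\<close>
    unfolding H_def[symmetric, unfolded G_def] zolotarev_def[of _ "distr M borel (\<lambda>\<omega>. ?c * (\<Sum>j\<in>{1..?K \<omega>}. X j \<omega>))"]
  proof (rule SUP_least)
    fix f assume f: "f \<in> zol_class s"
    have [measurable]: "f \<in> borel_measurable borel"
      using zol_class_continuous[OF s_ge s_le f] by (rule borel_measurable_continuous_onI)
    have [measurable]: "(\<lambda>\<omega>. ?c * (\<Sum>j\<in>{1..?K \<omega>}. X j \<omega>)) \<in> borel_measurable M"
      by (rule measurable_compose_countable[where f = "\<lambda>k \<omega>. ?c * (\<Sum>j\<in>{1..k}. X j \<omega>)"]) measurable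
    let ?A = "\<integral>x. f x \<partial>distr M borel (\<lambda>\<omega>. ?c * (\<Sum>j\<in>{1..?K \<omega>}. X j \<omega>))"
    let ?B = "\<integral>x. f x \<partial>distr M borel (\<lambda>\<omega>. ?T \<omega> / ?m)"
    let ?L = "\<integral>x. f x \<partial>distr M borel L"
    have "ereal \<bar>?A - ?L\<bar> \<le> ereal \<bar>?A - ?B\<bar> + ereal \<bar>?B - ?L\<bar>"
      by simp
    also have "ereal \<bar>?B - ?L\<bar> \<le> zolotarev s (distr M borel (\<lambda>\<omega>. ?T \<omega> / ?m)) (distr M borel L)"
      unfolding zolotarev_def by (rule SUP_upper[OF f])
    also have "ereal \<bar>?A - ?B\<bar> \<le> enn2ereal (\<integral>\<^sup>+\<omega>. ennreal (?T \<omega> powr (s / 2)) \<partial>M) * ereal H"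
      using bound[OF f] by (subst (1 2) integral_distr) measurable
    finally show "ereal \<bar>?A - ?L\<bar> \<le> enn2ereal (\<integral>\<^sup>+\<omega>. ennreal (?T \<omega> powr (s / 2)) \<partial>M) * ereal H
        + zolotarev s (distr M borel (\<lambda>\<omega>. ?T \<omega> / ?m)) (distr M borel L)"
      by (simp add: add_mono)
  qed
qed

end
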